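(* Consider the partial differential equation $$\begin{aligned}\Bigg\{&\left(\Big(\tfrac{\partial}{\partial t}+\lambda\Big)^2-c^2\tfrac{\partial^2}{\partial x^2}\right)\left(\Big(\tfrac{\partial}{\partial t}+\lambda\Big)^2-c^2\tfrac{\partial^2}{\partial y^2}\right)-4\lambda^2pq\Big(\tfrac{\partial}{\partial t}+\lambda\Big)^2\\&-\lambda^2(1-p-q)^2\left(2\Big(\tfrac{\partial}{\partial t}+\lambda\Big)^2-c^2\Delta\right)-4\lambda^3(p^2+q^2)(1-p-q)\Big(\tfrac{\partial}{\partial t}+\lambda\Big)\\&+\lambda^4\left[(1-p-q)^2-2pq\right]^2-\lambda^4(p^2+q^2)^2\Bigg\}u=0,\end{aligned}$$ where $\Delta=\frac{\partial^2}{\partial x^2}+\frac{\partial^2}{\partial y^2}$ is the Laplacian. For $\lambda,c\to+\infty$ with $\frac{c^2}{\lambda}\to1$, this partial differential equation becomes $$\frac{\partial u}{\partial t}=\frac14\,\frac{(1-p)+(1-q)}{(1-p)^2+(1-q)^2}\,\Delta u.$$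
   Context: The fourth-order equation is the one satisfied, in the interior $|x|+|y|<ct$ of the support (with $x\neq0$, $y\neq0$ when $p+q<1$), by the density $u(x,y,t)$ of the planar motion $(X(t),Y(t))$ which starts at the origin, has speed $c$ and directions $d_j=(\cos(\pi j/2),\sin(\pi j/2))$, $j$ mod 4, with uniformly distributed initial direction, and which at the events of a rate-$\lambda$ homogeneous Poisson process changes direction from $d_j$ to $d_{j+1}$, $d_{j-1}$, $d_{j+2}$ with probabilities $p$, $q$, $1-p-q$ respectively.
   Formalization: The case p = q = 0 is excluded: there the equation, divided by λ², tends to (2∂/∂t − ∂²/∂x²)(2∂/∂t − ∂²/∂y²)u = 0 rather than to the stated heat equation. *)

theory Defs
  imports "HOL-Analysis.Analysis"
begin

definition partial :: "'a::euclidean_space \<Rightarrow> ('a \<Rightarrow> real) \<Rightarrow> ('a \<Rightarrow> real)" where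
  "partial e u = (\<lambda>z. deriv (\<lambda>h. u (z + h *\<^sub>R e)) 0)"

(* C^k on S (meant for open S): the function and all its iterated partial derivatives, of total
   order at most k and taken in any order, exist and are continuous on S. *)
primrec C_class :: "nat \<Rightarrow> 'a::euclidean_space set \<Rightarrow> ('a \<Rightarrow> real) \<Rightarrow> bool" where
  "C_class 0 S u \<longleftrightarrow> continuous_on S u"
| "C_class (Suc k) S u \<longleftrightarrow> continuous_on S u \<and>
     (\<forall>e\<in>Basis. (\<forall>z\<in>S. (\<lambda>h. u (z + h *\<^sub>R e)) differentiable (at 0)) \<and>
        C_class k S (partial e u))"

(* v i tends to u at every point of S, together with all iterated partial derivatives
   of total order at most k. *)
primrec C_tendsto ::
  "nat \<Rightarrow> 'a::euclidean_space set \<Rightarrow> ('i \<Rightarrow> 'a \<Rightarrow> real) \<Rightarrow> ('a \<Rightarrow> real) \<Rightarrow> 'i filter \<Rightarrow> bool" where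
  "C_tendsto 0 S v u F \<longleftrightarrow> (\<forall>z\<in>S. ((\<lambda>i. v i z) \<longlongrightarrow> u z) F)"
| "C_tendsto (Suc k) S v u F \<longleftrightarrow> (\<forall>z\<in>S. ((\<lambda>i. v i z) \<longlongrightarrow> u z) F) \<and>
     (\<forall>e\<in>Basis. C_tendsto k S (\<lambda>i. partial e (v i)) (partial e u) F)"

(* A point of space-time is a triple (x, y, t). *)
type_synonym spacetime = "real \<times> real \<times> real"

definition Dx :: "(spacetime \<Rightarrow> real) \<Rightarrow> spacetime \<Rightarrow> real" where
  "Dx = partial (1, 0, 0)"

definition Dy :: "(spacetime \<Rightarrow> real) \<Rightarrow> spacetime \<Rightarrow> real" where
  "Dy = partial (0, 1, 0)"

definition Dt :: "(spacetime \<Rightarrow> real) \<Rightarrow> spacetime \<Rightarrow> real" where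
  "Dt = partial (0, 0, 1)"

definition Laplace :: "(spacetime \<Rightarrow> real) \<Rightarrow> spacetime \<Rightarrow> real" where
  "Laplace u = (\<lambda>z. Dx (Dx u) z + Dy (Dy u) z)"

definition damped_Dt :: "real \<Rightarrow> (spacetime \<Rightarrow> real) \<Rightarrow> spacetime \<Rightarrow> real" where
  "damped_Dt lam u = (\<lambda>z. Dt u z + lam * u z)"

definition telegraph_x :: "real \<Rightarrow> real \<Rightarrow> (spacetime \<Rightarrow> real) \<Rightarrow> spacetime \<Rightarrow> real" where
  "telegraph_x lam c u = (\<lambda>z. (damped_Dt lam ^^ 2) u z - c\<^sup>2 * Dx (Dx u) z)"

definition telegraph_y :: "real \<Rightarrow> real \<Rightarrow> (spacetime \<Rightarrow> real) \<Rightarrow> spacetime \<Rightarrow> real" where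
  "telegraph_y lam c u = (\<lambda>z. (damped_Dt lam ^^ 2) u z - c\<^sup>2 * Dy (Dy u) z)"

definition planar_op ::
  "real \<Rightarrow> real \<Rightarrow> real \<Rightarrow> real \<Rightarrow> (spacetime \<Rightarrow> real) \<Rightarrow> spacetime \<Rightarrow> real" where
  "planar_op p q lam c u = (\<lambda>z.
       telegraph_x lam c (telegraph_y lam c u) z
     - 4 * lam\<^sup>2 * p * q * (damped_Dt lam ^^ 2) u z
     - lam\<^sup>2 * (1 - p - q)\<^sup>2 * (2 * (damped_Dt lam ^^ 2) u z - c\<^sup>2 * Laplace u z)
     - 4 * lam ^ 3 * (p\<^sup>2 + q\<^sup>2) * (1 - p - q) * damped_Dt lam u z
     + lam ^ 4 * ((1 - p - q)\<^sup>2 - 2 * p * q)\<^sup>2 * u z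
     - lam ^ 4 * (p\<^sup>2 + q\<^sup>2)\<^sup>2 * u z)"

definition diffusivity :: "real \<Rightarrow> real \<Rightarrow> real" where
  "diffusivity p q = 1 / 4 * (((1 - p) + (1 - q)) / ((1 - p)\<^sup>2 + (1 - q)\<^sup>2))"

end

theory Submission
  imports Defs
begin

text \<open>Divide the equation by \<open>\<lambda>\<^sup>3\<close> and expand it in powers of \<open>1/\<lambda>\<close>, with \<open>c\<^sup>2/\<lambda> \<longrightarrow> 1\<close>.
  The coefficient of \<open>u\<close>, of order \<open>\<lambda>\<close>, vanishes identically in \<open>p\<close> and \<open>q\<close>; only the first time
  derivative and the Laplacian survive in the limit, with coefficients
  \<open>4 (p + q) ((1 - p)\<^sup>2 + (1 - q)\<^sup>2)\<close> and \<open>- (p + q) (2 - p - q)\<close>. Up to sign, the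
  ratio of the second to the first is the diffusivity.
  No derivatives need to be interchanged, because the convergence hypothesis covers partial
  derivatives taken in every order.\<close>

section \<open>Locality and linearity of partial derivatives on open sets\<close>

lemma eventually_line_in_open:
  fixes z e :: "'a::real_normed_vector"
  assumes "open S" "z \<in> S"
  shows "\<forall>\<^sub>F h in nhds (0::real). z + h *\<^sub>R e \<in> S"
proof -
  have "((\<lambda>h::real. z + h *\<^sub>R e) \<longlongrightarrow> z + 0 *\<^sub>R e) (nhds 0)"
    by (intro tendsto_intros filterlim_ident)
  then show ?thesis
    using topological_tendstoD[OF _ assms(1)] assms(2) by fastforce
qed

text \<open>A derivative along a line depends only on values near \<open>z\<close>, and openness
  keeps a short segment of the line in \<open>S\<close>. Identities known only on \<open>S\<close>
  can thus be differentiated, although \<open>partial\<close> acts on total functions.\<close>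

lemma partial_cong:
  assumes "open S" "z \<in> S" "\<And>w. w \<in> S \<Longrightarrow> f w = g w"
  shows "partial e f z = partial e g z"
  unfolding partial_def
  by (rule deriv_cong_ev) (use eventually_line_in_open[OF assms(1,2), of e] assms(3) in
      \<open>auto elim: eventually_mono\<close>)

text \<open>Induction on \<open>k\<close> with both functions generalized: by locality the partial
  derivatives again agree on \<open>S\<close>, so the induction hypothesis applies to them.\<close>

lemma C_class_cong:
  assumes "open S" "\<And>w. w \<in> S \<Longrightarrow> f w = g w" "C_class k S f"
  shows "C_class k S g"
  using assms(2,3)
proof (induction k arbitrary: f g)
  case 0
  then show ?case
    using continuous_on_cong[of S S f g] by simp
next
  case (Suc k)
  have "(\<lambda>h. g (z + h *\<^sub>R e)) differentiable (at 0)" if "e \<in> Basis" "z \<in> S" for e z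
  proof -
    have "(\<lambda>h. f (z + h *\<^sub>R e)) differentiable (at 0)"
      using Suc.prems that by simp
    then obtain D where D: "((\<lambda>h. f (z + h *\<^sub>R e)) has_real_derivative D) (at 0)"
      using real_differentiable_def by blast
    have "\<forall>\<^sub>F h in nhds 0. f (z + h *\<^sub>R e) = g (z + h *\<^sub>R e)"
      using eventually_line_in_open[OF assms(1) \<open>z \<in> S\<close>, of e] Suc.prems(1)
      by (auto elim: eventually_mono)
    then have "((\<lambda>h. g (z + h *\<^sub>R e)) has_real_derivative D) (at 0)"
      using D by (simp add: DERIV_cong_ev[OF refl _ refl])
    then show ?thesis
      using real_differentiable_def by blast
  qed
  moreover have "C_class k S (partial e g)" if "e \<in> Basis" for e
  proof (rule Suc.IH)
    show "partial e f w = partial e g w" if "w \<in> S" for w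
      by (rule partial_cong[OF assms(1) that Suc.prems(1)])
    show "C_class k S (partial e f)"
      using Suc.prems(2) that by simp
  qed
  moreover have "continuous_on S g"
    using Suc.prems continuous_on_cong[of S S f g] by simp
  ultimately show ?case
    by simp
qed

lemma C_class_Suc_imp: "C_class (Suc k) S f \<Longrightarrow> C_class k S f"
  by (induction k arbitrary: f) auto

lemma C_class_partial: "C_class (Suc k) S f \<Longrightarrow> e \<in> Basis \<Longrightarrow> C_class k S (partial e f)"
  by simp

text \<open>\<open>deriv\<close> is total, so linearity rests on genuine differentiability, which
  \<open>C_class (Suc k)\<close> supplies. Iterating the shape \<open>f + a * g\<close> builds the
  linear combinations used below.\<close>

lemma partial_add_cmult_DERIV:
  assumes "C_class (Suc k) S f" "C_class (Suc k) S g" "e \<in> Basis" "z \<in> S"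
  shows "((\<lambda>h. f (z + h *\<^sub>R e) + a * g (z + h *\<^sub>R e)) has_real_derivative
           partial e f z + a * partial e g z) (at 0)"
proof -
  have "((\<lambda>h. f (z + h *\<^sub>R e)) has_real_derivative partial e f z) (at 0)"
       "((\<lambda>h. g (z + h *\<^sub>R e)) has_real_derivative partial e g z) (at 0)"
    using assms unfolding partial_def by (auto simp: DERIV_deriv_iff_real_differentiable)
  then show ?thesis
    by (intro DERIV_add DERIV_cmult)
qed

lemma partial_add_cmult:
  assumes "C_class (Suc k) S f" "C_class (Suc k) S g" "e \<in> Basis" "z \<in> S"
  shows "partial e (\<lambda>w. f w + a * g w) z = partial e f z + a * partial e g z"
  using DERIV_imp_deriv[OF partial_add_cmult_DERIV[OF assms]] by (simp add: partial_def)

lemma C_class_add_cmult: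
  assumes "open S" "C_class k S f" "C_class k S g"
  shows "C_class k S (\<lambda>w. f w + a * g w)"
  using assms(2,3)
proof (induction k arbitrary: f g)
  case 0
  then show ?case
    by (auto intro!: continuous_intros)
next
  case (Suc k)
  have "(\<lambda>h. f (z + h *\<^sub>R e) + a * g (z + h *\<^sub>R e)) differentiable (at 0)"
    if "e \<in> Basis" "z \<in> S" for e z
    using partial_add_cmult_DERIV[OF Suc.prems that] real_differentiable_def by blast
  moreover have "C_class k S (partial e (\<lambda>w. f w + a * g w))" if "e \<in> Basis" for e
  proof (rule C_class_cong[OF assms(1)])
    show "C_class k S (\<lambda>w. partial e f w + a * partial e g w)"
      using Suc.IH Suc.prems that by simp
  qed (simp add: partial_add_cmult[OF Suc.prems that])
  moreover have "continuous_on S (\<lambda>w. f w + a * g w)"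
    using Suc.prems by (auto intro!: continuous_intros)
  ultimately show ?case
    by simp
qed

text \<open>The inner identity holds only on \<open>S\<close>; \<open>partial_cong\<close> carries
  it under the outer derivative, where linearity applies again.\<close>

lemma partial_partial_add_cmult:
  assumes "open S" "C_class (Suc (Suc k)) S f" "C_class (Suc (Suc k)) S g"
    and "e \<in> Basis" "e' \<in> Basis" "z \<in> S"
  shows "partial e (partial e' (\<lambda>w. f w + a * g w)) z =
    partial e (partial e' f) z + a * partial e (partial e' g) z"
proof -
  have "partial e (partial e' (\<lambda>w. f w + a * g w)) z =
      partial e (\<lambda>w. partial e' f w + a * partial e' g w) z"
    by (rule partial_cong[OF assms(1,6)]) (rule partial_add_cmult[OF assms(2,3,5)])
  also have "\<dots> = partial e (partial e' f) z + a * partial e (partial e' g) z"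
    by (rule partial_add_cmult[OF C_class_partial C_class_partial]) (fact assms)+
  finally show ?thesis .
qed

section \<open>Convergence of derivatives and the coordinate directions\<close>

lemma C_tendsto_partial:
  "C_tendsto (Suc k) S v u F \<Longrightarrow> e \<in> Basis \<Longrightarrow>
    C_tendsto k S (\<lambda>i. partial e (v i)) (partial e u) F"
  by simp

lemma C_tendsto_imp_tendsto: "C_tendsto k S v u F \<Longrightarrow> z \<in> S \<Longrightarrow> ((\<lambda>i. v i z) \<longlongrightarrow> u z) F"
  by (cases k) auto

lemma spacetime_Basis:
  "(1, 0, 0) \<in> (Basis :: spacetime set)" "(0, 1, 0) \<in> (Basis :: spacetime set)"
  "(0, 0, 1) \<in> (Basis :: spacetime set)"
  by (auto simp: Basis_prod_def zero_prod_def)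

lemma C_class_D:
  assumes "C_class (Suc k) S f"
  shows "C_class k S (Dx f)" "C_class k S (Dy f)" "C_class k S (Dt f)"
  using C_class_partial[OF assms] spacetime_Basis unfolding Dx_def Dy_def Dt_def by blast+

lemma C_tendsto_D:
  assumes "C_tendsto (Suc k) S v u F"
  shows "C_tendsto k S (\<lambda>i. Dx (v i)) (Dx u) F" "C_tendsto k S (\<lambda>i. Dy (v i)) (Dy u) F"
    "C_tendsto k S (\<lambda>i. Dt (v i)) (Dt u) F"
  using C_tendsto_partial[OF assms] spacetime_Basis unfolding Dx_def Dy_def Dt_def by blast+

section \<open>Expansion of the fourth-order operator\<close>

lemma damped_Dt_squared:
  assumes "open S" "C_class (Suc (Suc k)) S f" "z \<in> S"
  shows "(damped_Dt l ^^ 2) f z = Dt (Dt f) z + 2 * l * Dt f z + l\<^sup>2 * f z"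
proof -
  have "Dt (\<lambda>w. Dt f w + l * f w) z = Dt (Dt f) z + l * Dt f z"
    unfolding Dt_def
    by (rule partial_add_cmult[OF C_class_partial C_class_Suc_imp])
      (fact assms spacetime_Basis)+
  then show ?thesis
    by (simp add: numeral_2_eq_2 damped_Dt_def algebra_simps)
qed

text \<open>Allows the expanded form of \<open>telegraph_y\<close>, valid only on \<open>S\<close>,
  to replace it inside \<open>telegraph_x\<close>.\<close>

lemma telegraph_x_cong:
  assumes "open S" "z \<in> S" "\<And>w. w \<in> S \<Longrightarrow> f w = g w"
  shows "telegraph_x l c f z = telegraph_x l c g z"
proof -
  have first: "partial e f w = partial e g w" if "w \<in> S" for e w
    by (rule partial_cong[OF assms(1) that assms(3)])
  have "Dx (Dx f) z = Dx (Dx g) z"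
    unfolding Dx_def by (rule partial_cong[OF assms(1,2) first])
  moreover have damped: "damped_Dt l f w = damped_Dt l g w" if "w \<in> S" for w
    using that by (simp add: damped_Dt_def Dt_def first assms(3))
  moreover have "Dt (damped_Dt l f) z = Dt (damped_Dt l g) z"
    unfolding Dt_def by (rule partial_cong[OF assms(1,2) damped])
  ultimately show ?thesis
    using assms(2)
    by (simp add: telegraph_x_def numeral_2_eq_2 damped_Dt_def[of l "damped_Dt l f"]
        damped_Dt_def[of l "damped_Dt l g"])
qed

lemma four_eq_Suc: "4 = Suc (Suc (Suc (Suc 0)))"
  by simp

text \<open>The coefficients 1, 4, 6, 4, 1 are those of \<open>(Dt + l)^4\<close>. Mixed derivatives
  stay in the order in which they arise: \<open>Dt\<close> outside \<open>Dy\<close>, but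
  \<open>Dx\<close> outside \<open>Dt\<close>.\<close>

lemma telegraph_x_telegraph_y:
  assumes S: "open S" "z \<in> S" and v: "C_class 4 S v"
  shows "telegraph_x l c (telegraph_y l c v) z =
      Dt (Dt (Dt (Dt v))) z + 4 * l * Dt (Dt (Dt v)) z + 6 * l\<^sup>2 * Dt (Dt v) z
    + 4 * l ^ 3 * Dt v z + l ^ 4 * v z
    - c\<^sup>2 * (Dt (Dt (Dy (Dy v))) z + 2 * l * Dt (Dy (Dy v)) z + l\<^sup>2 * Dy (Dy v) z)
    - c\<^sup>2 * (Dx (Dx (Dt (Dt v))) z + 2 * l * Dx (Dx (Dt v)) z + l\<^sup>2 * Dx (Dx v) z)
    + c ^ 4 * Dx (Dx (Dy (Dy v))) z"
proof -
  \<comment> \<open>\<open>f3\<close> is the expanded \<open>telegraph_y l c v\<close>, built from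
    three steps \<open>f + a * g\<close> so that linearity applies to one summand at a time. As
    \<open>v\<close> is of class 4, each stage is of class 2, enough for the outer operator.\<close>
  define f1 where "f1 = (\<lambda>w. Dt (Dt v) w + 2 * l * Dt v w)"
  define f2 where "f2 = (\<lambda>w. f1 w + l\<^sup>2 * v w)"
  define f3 where "f3 = (\<lambda>w. f2 w + (- c\<^sup>2) * Dy (Dy v) w)"
  note [simp del] = C_class.simps
  have v4: "C_class (Suc (Suc (Suc (Suc 0)))) S v"
    using v by (simp only: four_eq_Suc)
  note v2 = C_class_Suc_imp[OF C_class_Suc_imp[OF v4]]
  note t2 = C_class_Suc_imp[OF C_class_D(3)[OF v4]]
  note tt2 = C_class_D(3)[OF C_class_D(3)[OF v4]]
  note yy2 = C_class_D(2)[OF C_class_D(2)[OF v4]]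
  have f1: "C_class (Suc (Suc 0)) S f1"
    unfolding f1_def by (rule C_class_add_cmult[OF S(1) tt2 t2])
  have f2: "C_class (Suc (Suc 0)) S f2"
    unfolding f2_def by (rule C_class_add_cmult[OF S(1) f1 v2])
  have f3: "C_class (Suc (Suc 0)) S f3"
    unfolding f3_def by (rule C_class_add_cmult[OF S(1) f2 yy2])
  \<comment> \<open>A generic direction \<open>e\<close> serves both the time and the x
    derivatives.\<close>
  have second: "partial e (partial e f3) z = partial e (partial e (Dt (Dt v))) z
      + 2 * l * partial e (partial e (Dt v)) z + l\<^sup>2 * partial e (partial e v) z
      + (- c\<^sup>2) * partial e (partial e (Dy (Dy v))) z" if e: "e \<in> Basis" for e
    using partial_partial_add_cmult[OF S(1) tt2 t2 e e S(2), of "2 * l", folded f1_def]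
      partial_partial_add_cmult[OF S(1) f1 v2 e e S(2), of "l\<^sup>2", folded f2_def]
      partial_partial_add_cmult[OF S(1) f2 yy2 e e S(2), of "- c\<^sup>2", folded f3_def]
    by simp
  have first: "Dt f3 z = Dt (Dt (Dt v)) z + 2 * l * Dt (Dt v) z + l\<^sup>2 * Dt v z
      + (- c\<^sup>2) * Dt (Dy (Dy v)) z"
    using partial_add_cmult[OF tt2 t2 spacetime_Basis(3) S(2), of "2 * l",
        folded f1_def, folded Dt_def]
      partial_add_cmult[OF f1 v2 spacetime_Basis(3) S(2), of "l\<^sup>2",
        folded f2_def, folded Dt_def]
      partial_add_cmult[OF f2 yy2 spacetime_Basis(3) S(2), of "- c\<^sup>2",
        folded f3_def, folded Dt_def]
    by simp
  have "telegraph_x l c (telegraph_y l c v) z = telegraph_x l c f3 z"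
    by (rule telegraph_x_cong[OF S])
      (simp add: telegraph_y_def damped_Dt_squared[OF S(1) v2] f1_def f2_def f3_def)
  also have "\<dots> = Dt (Dt f3) z + 2 * l * Dt f3 z + l\<^sup>2 * f3 z - c\<^sup>2 * Dx (Dx f3) z"
    by (simp add: telegraph_x_def damped_Dt_squared[OF S(1) f3 S(2)])
  also have "f3 z = Dt (Dt v) z + 2 * l * Dt v z + l\<^sup>2 * v z + (- c\<^sup>2) * Dy (Dy v) z"
    by (simp add: f1_def f2_def f3_def)
  finally show ?thesis
    unfolding first second[OF spacetime_Basis(3), folded Dt_def]
      second[OF spacetime_Basis(1), folded Dx_def]
    by (simp add: algebra_simps power3_eq_cube power4_eq_xxxx power2_eq_square)
qed

text \<open>With \<open>c^2\<close> comparable to \<open>l\<close>, the leading terms have order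
  \<open>l^3\<close>. In terms of \<open>h\<close> and \<open>k\<close>, every term other than those
  with \<open>Dt v\<close> and \<open>Laplace v\<close> carries a factor \<open>h\<close>, which
  will tend to 0 while \<open>k\<close> tends to 1.\<close>

lemma planar_op_scaled:
  fixes l c p q :: real
  assumes S: "open S" "z \<in> S" and v: "C_class 4 S v" and "l \<noteq> 0"
  defines "h \<equiv> 1 / l" and "k \<equiv> c\<^sup>2 / l" and "r \<equiv> 1 - p - q"
  shows "planar_op p q l c v z / l ^ 3 =
      4 * (p + q) * ((1 - p)\<^sup>2 + (1 - q)\<^sup>2) * Dt v z - k * (p + q) * (2 - p - q) * Laplace v z
    + h ^ 3 * Dt (Dt (Dt (Dt v))) z + 4 * h\<^sup>2 * Dt (Dt (Dt v)) z
    + h * (6 - 4 * p * q - 2 * r\<^sup>2) * Dt (Dt v) z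
    - k * h\<^sup>2 * (Dt (Dt (Dy (Dy v))) z + Dx (Dx (Dt (Dt v))) z)
    - 2 * k * h * (Dt (Dy (Dy v)) z + Dx (Dx (Dt v)) z)
    + k\<^sup>2 * h * Dx (Dx (Dy (Dy v))) z" (is "_ = ?R")
proof -
  have v4: "C_class (Suc (Suc (Suc (Suc 0)))) S v"
    using v by (simp only: four_eq_Suc)
  note v2 = C_class_Suc_imp[OF C_class_Suc_imp[OF v4]]
  \<comment> \<open>The last two squares differ by
    \<open>(r^2 - (p + q)^2) * (r^2 + (p - q)^2)\<close>, and the first factor is
    \<open>2 * r - 1\<close> because \<open>p + q = 1 - r\<close>.\<close>
  have coeff0: "1 - 4 * p * q - 2 * r\<^sup>2 - 4 * (p\<^sup>2 + q\<^sup>2) * r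
      + (r\<^sup>2 - 2 * p * q)\<^sup>2 - (p\<^sup>2 + q\<^sup>2)\<^sup>2 = 0"
    unfolding r_def by (simp add: algebra_simps power2_eq_square)
  \<comment> \<open>Here \<open>(1 - p)^2 + (1 - q)^2 = 2 * r + p^2 + q^2\<close>.\<close>
  have coeff1: "4 - 8 * p * q - 4 * r\<^sup>2 - 4 * (p\<^sup>2 + q\<^sup>2) * r =
      4 * (p + q) * ((1 - p)\<^sup>2 + (1 - q)\<^sup>2)"
    unfolding r_def by (simp add: algebra_simps power2_eq_square)
  have coeff2: "1 - r\<^sup>2 = (p + q) * (2 - p - q)"
    unfolding r_def by (simp add: algebra_simps power2_eq_square)
  have "planar_op p q l c v z =
      l ^ 4 * (1 - 4 * p * q - 2 * r\<^sup>2 - 4 * (p\<^sup>2 + q\<^sup>2) * r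
        + (r\<^sup>2 - 2 * p * q)\<^sup>2 - (p\<^sup>2 + q\<^sup>2)\<^sup>2) * v z
    + l ^ 3 * (4 - 8 * p * q - 4 * r\<^sup>2 - 4 * (p\<^sup>2 + q\<^sup>2) * r) * Dt v z
    - l\<^sup>2 * c\<^sup>2 * (1 - r\<^sup>2) * Laplace v z
    + Dt (Dt (Dt (Dt v))) z + 4 * l * Dt (Dt (Dt v)) z
    + l\<^sup>2 * (6 - 4 * p * q - 2 * r\<^sup>2) * Dt (Dt v) z
    - c\<^sup>2 * (Dt (Dt (Dy (Dy v))) z + Dx (Dx (Dt (Dt v))) z)
    - 2 * l * c\<^sup>2 * (Dt (Dy (Dy v)) z + Dx (Dx (Dt v)) z)
    + c ^ 4 * Dx (Dx (Dy (Dy v))) z"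
    unfolding planar_op_def telegraph_x_telegraph_y[OF S v] damped_Dt_squared[OF S(1) v2 S(2)]
      damped_Dt_def Laplace_def r_def[symmetric]
    by (simp add: algebra_simps power3_eq_cube power4_eq_xxxx power2_eq_square)
  also have "\<dots> = l ^ 3 * ?R"
    unfolding coeff0 coeff1 coeff2
    using \<open>l \<noteq> 0\<close> by (simp add: h_def k_def field_simps eval_nat_numeral)
  finally have "planar_op p q l c v z = l ^ 3 * ?R" .
  then show ?thesis
    using \<open>l \<noteq> 0\<close> by simp
qed

section \<open>Passage to the limit in the rescaled operator\<close>

lemma planar_op_scaled_tendsto:
  fixes lam c :: "'i \<Rightarrow> real"
  assumes S: "open S" "z \<in> S" and v: "\<forall>\<^sub>F i in F. C_class 4 S (v i)"
    and "C_tendsto 4 S v u F"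
    and lam: "filterlim lam at_top F" and k: "((\<lambda>i. (c i)\<^sup>2 / lam i) \<longlongrightarrow> 1) F"
  shows "((\<lambda>i. planar_op p q (lam i) (c i) (v i) z / lam i ^ 3) \<longlongrightarrow>
      4 * (p + q) * ((1 - p)\<^sup>2 + (1 - q)\<^sup>2) * Dt u z - (p + q) * (2 - p - q) * Laplace u z) F"
proof -
  have u4: "C_tendsto (Suc (Suc (Suc (Suc 0)))) S v u F"
    using assms(4) by (simp only: four_eq_Suc)
  \<comment> \<open>Each list applies \<open>Dx\<close>, \<open>Dy\<close> and \<open>Dt\<close> to
    every entry of the previous one, giving the iterated derivatives of orders 1 to 4 in every
    order.\<close>
  note d1 = C_tendsto_D[OF u4]
  note d2 = d1[THEN C_tendsto_D(1)] d1[THEN C_tendsto_D(2)] d1[THEN C_tendsto_D(3)]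
  note d3 = d2[THEN C_tendsto_D(1)] d2[THEN C_tendsto_D(2)] d2[THEN C_tendsto_D(3)]
  note d4 = d3[THEN C_tendsto_D(1)] d3[THEN C_tendsto_D(2)] d3[THEN C_tendsto_D(3)]
  note lims = d1[THEN C_tendsto_imp_tendsto, OF S(2)] d2[THEN C_tendsto_imp_tendsto, OF S(2)]
    d3[THEN C_tendsto_imp_tendsto, OF S(2)] d4[THEN C_tendsto_imp_tendsto, OF S(2)]
  have h: "((\<lambda>i. 1 / lam i) \<longlongrightarrow> 0) F"
    using tendsto_inverse_0_at_top[OF lam] by (simp add: inverse_eq_divide)
  let ?R = "\<lambda>h k i.
      4 * (p + q) * ((1 - p)\<^sup>2 + (1 - q)\<^sup>2) * Dt (v i) z
    - k * (p + q) * (2 - p - q) * (Dx (Dx (v i)) z + Dy (Dy (v i)) z)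
    + h ^ 3 * Dt (Dt (Dt (Dt (v i)))) z + 4 * h\<^sup>2 * Dt (Dt (Dt (v i))) z
    + h * (6 - 4 * p * q - 2 * (1 - p - q)\<^sup>2) * Dt (Dt (v i)) z
    - k * h\<^sup>2 * (Dt (Dt (Dy (Dy (v i)))) z + Dx (Dx (Dt (Dt (v i)))) z)
    - 2 * k * h * (Dt (Dy (Dy (v i))) z + Dx (Dx (Dt (v i))) z)
    + k\<^sup>2 * h * Dx (Dx (Dy (Dy (v i)))) z"
  \<comment> \<open>The limit keeps its factors 0 and 1 unsimplified, so that it matches
    \<open>?R\<close> term by term under the limit rules.\<close>
  have R: "((\<lambda>i. ?R (1 / lam i) ((c i)\<^sup>2 / lam i) i) \<longlongrightarrow>
      4 * (p + q) * ((1 - p)\<^sup>2 + (1 - q)\<^sup>2) * Dt u z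
    - 1 * (p + q) * (2 - p - q) * (Dx (Dx u) z + Dy (Dy u) z)
    + 0 ^ 3 * Dt (Dt (Dt (Dt u))) z + 4 * 0\<^sup>2 * Dt (Dt (Dt u)) z
    + 0 * (6 - 4 * p * q - 2 * (1 - p - q)\<^sup>2) * Dt (Dt u) z
    - 1 * 0\<^sup>2 * (Dt (Dt (Dy (Dy u))) z + Dx (Dx (Dt (Dt u))) z)
    - 2 * 1 * 0 * (Dt (Dy (Dy u)) z + Dx (Dx (Dt u)) z)
    + 1\<^sup>2 * 0 * Dx (Dx (Dy (Dy u))) z) F"
    by (intro tendsto_add tendsto_diff tendsto_mult tendsto_power tendsto_const h k lims)
  \<comment> \<open>The expansion is available only eventually, once \<open>v i\<close> is of class
    4 and \<open>lam i\<close> is positive.\<close>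
  have "\<forall>\<^sub>F i in F. ?R (1 / lam i) ((c i)\<^sup>2 / lam i) i =
      planar_op p q (lam i) (c i) (v i) z / lam i ^ 3"
    using v filterlim_at_top_dense[THEN iffD1, OF lam, rule_format, of 0]
  proof eventually_elim
    case (elim i)
    then show ?case
      using planar_op_scaled[OF S elim(1), of "lam i" p q "c i"] by (simp add: Laplace_def)
  qed
  from Lim_transform_eventually[OF R this] show ?thesis
    by (simp add: Laplace_def)
qed

section \<open>Normalisation and the limiting diffusion equation\<close>

theorem theorem6:
  fixes p q :: real and lam c :: "'i \<Rightarrow> real" and F :: "'i filter"
  assumes "0 \<le> p" and "0 \<le> q" and "p + q \<le> 1" and "0 < p + q"
    and "F \<noteq> bot"
    and "filterlim lam at_top F" and "filterlim c at_top F"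
    and "((\<lambda>i. (c i)\<^sup>2 / lam i) \<longlongrightarrow> 1) F"
  shows "(\<exists>m. (\<forall>\<^sub>F i in F. m i \<noteq> 0) \<and>
           (\<forall>S v u. open S \<longrightarrow> (\<forall>\<^sub>F i in F. C_class 4 S (v i)) \<longrightarrow> C_class 4 S u \<longrightarrow>
              C_tendsto 4 S v u F \<longrightarrow>
              (\<forall>z\<in>S. ((\<lambda>i. m i * planar_op p q (lam i) (c i) (v i) z)
                       \<longlongrightarrow> Dt u z - diffusivity p q * Laplace u z) F)))
       \<and> (\<forall>S v u. open S \<longrightarrow> (\<forall>\<^sub>F i in F. C_class 4 S (v i)) \<longrightarrow> C_class 4 S u \<longrightarrow>
           C_tendsto 4 S v u F \<longrightarrow>
           (\<forall>\<^sub>F i in F. \<forall>z\<in>S. planar_op p q (lam i) (c i) (v i) z = 0) \<longrightarrow>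
           (\<forall>z\<in>S. Dt u z = diffusivity p q * Laplace u z))"
proof -
  \<comment> \<open>\<open>K\<close> is the limiting coefficient of \<open>Dt u\<close> after
    division by \<open>lam^3\<close>; the multiplier \<open>m\<close> normalises that coefficient to
    1.\<close>
  define K where "K = 4 * (p + q) * ((1 - p)\<^sup>2 + (1 - q)\<^sup>2)"
  define m where "m i = 1 / (lam i ^ 3 * K)" for i
  \<comment> \<open>\<open>p = q = 1\<close> would contradict \<open>p + q \<le> 1\<close>; together
    with \<open>0 < p + q\<close> this makes \<open>K\<close> nonzero.\<close>
  have "p \<noteq> 1 \<or> q \<noteq> 1"
    using assms by linarith
  then have pos: "(1 - p)\<^sup>2 + (1 - q)\<^sup>2 > 0"
    by (simp add: sum_power2_gt_zero_iff)
  then have K: "K \<noteq> 0"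
    using assms by (simp add: K_def)
  have diffusivity: "diffusivity p q = (p + q) * (2 - p - q) / K"
  proof -
    \<comment> \<open>Naming the sum of squares keeps it a single nonzero denominator; the factor
      \<open>p + q\<close> then cancels.\<close>
    define W where "W = (1 - p)\<^sup>2 + (1 - q)\<^sup>2"
    show ?thesis
      using pos \<open>0 < p + q\<close> unfolding diffusivity_def K_def W_def[symmetric]
      by (simp add: divide_simps) (simp add: algebra_simps)
  qed
  have m: "\<forall>\<^sub>F i in F. m i \<noteq> 0"
    using filterlim_at_top_dense[THEN iffD1, OF assms(6), rule_format, of 0]
    by eventually_elim (use K in \<open>simp add: m_def\<close>)
  have lim: "((\<lambda>i. m i * planar_op p q (lam i) (c i) (v i) z)
      \<longlongrightarrow> Dt u z - diffusivity p q * Laplace u z) F"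
    if "open S" "\<forall>\<^sub>F i in F. C_class 4 S (v i)" "C_tendsto 4 S v u F" "z \<in> S" for S v u z
  proof -
    have "((\<lambda>i. planar_op p q (lam i) (c i) (v i) z / lam i ^ 3 / K) \<longlongrightarrow>
        (K * Dt u z - (p + q) * (2 - p - q) * Laplace u z) / K) F"
      unfolding K_def[symmetric]
      using planar_op_scaled_tendsto[OF that(1,4,2,3) assms(6,8), of p q, folded K_def] K
      by (intro tendsto_divide tendsto_const)
    moreover have "(K * Dt u z - (p + q) * (2 - p - q) * Laplace u z) / K =
        Dt u z - diffusivity p q * Laplace u z"
      using K by (simp add: diffusivity diff_divide_distrib)
    ultimately show ?thesis
      by (simp add: m_def)
  qed
  have "Dt u z = diffusivity p q * Laplace u z"
    if "open S" "\<forall>\<^sub>F i in F. C_class 4 S (v i)" "C_tendsto 4 S v u F" "z \<in> S"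
      and zero: "\<forall>\<^sub>F i in F. \<forall>z\<in>S. planar_op p q (lam i) (c i) (v i) z = 0" for S v u z
  proof -
    \<comment> \<open>For solutions the normalised expressions are eventually 0, so uniqueness of
      limits along the nontrivial filter \<open>F\<close> forces the limit equation.\<close>
    have "\<forall>\<^sub>F i in F. m i * planar_op p q (lam i) (c i) (v i) z = 0"
      using zero by eventually_elim (use \<open>z \<in> S\<close> in simp)
    then have "((\<lambda>i. m i * planar_op p q (lam i) (c i) (v i) z) \<longlongrightarrow> 0) F"
      by (rule tendsto_eventually)
    from tendsto_unique[OF assms(5) lim[OF that(1-4)] this] show ?thesis
      by simp
  qed
  with m lim show ?thesis
    by blast
qed

end
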